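(* Let $G$ be a split graph. Then $\operatorname{bp}(G)\geq \operatorname{mc}(G^c)-2$.
   Context: A finite simple graph $G=(V,E)$ is a split graph if $V$ can be partitioned into $V_1,V_2$ with $G(V_1)$ a clique and $V_2$ an independent set. $\operatorname{mc}(H)$ is the number of maximal cliques of $H$. A biclique $\{L,R\}$ is the complete bipartite graph with disjoint vertex sets $L,R$ and edge set $\{uv:u\in L,v\in R\}$; a biclique partition of $G$ is a collection of biclique subgraphs of $G$ such that every edge lies in exactly one of them; $\operatorname{bp}(G)$ is the minimum size of a biclique partition. *)

theory Defs
  imports "HOL-Library.Ramsey"
begin

text \<open>A graph is a pair \<open>(V, E)\<close> of a vertex set and a set of two-element edges.\<close>

type_synonym 'a ugraph = "'a set \<times> 'a set set"

definition fin_simple_graph :: "'a ugraph \<Rightarrow> bool" where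
  "fin_simple_graph G \<longleftrightarrow> finite (fst G) \<and> snd G \<subseteq> [fst G]\<^bsup>2\<^esup>"

definition compl_graph :: "'a ugraph \<Rightarrow> 'a ugraph" where
  "compl_graph G = (fst G, [fst G]\<^bsup>2\<^esup> - snd G)"

definition subgraph_of :: "'a ugraph \<Rightarrow> 'a ugraph \<Rightarrow> bool" where
  "subgraph_of H G \<longleftrightarrow> fst H \<subseteq> fst G \<and> snd H \<subseteq> snd G"

definition split_graph :: "'a ugraph \<Rightarrow> bool" where
  "split_graph G \<longleftrightarrow> fin_simple_graph G \<and>
     (\<exists>V1 V2. V1 \<union> V2 = fst G \<and> V1 \<inter> V2 = {} \<and> clique V1 (snd G) \<and> indep V2 (snd G))"

definition maximal_clique :: "'a ugraph \<Rightarrow> 'a set \<Rightarrow> bool" where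
  "maximal_clique G K \<longleftrightarrow> K \<subseteq> fst G \<and> clique K (snd G) \<and>
     (\<forall>K'. K \<subseteq> K' \<and> K' \<subseteq> fst G \<and> clique K' (snd G) \<longrightarrow> K' = K)"

definition mc :: "'a ugraph \<Rightarrow> nat" where
  "mc G = card {K. maximal_clique G K}"

definition biclique :: "'a set \<Rightarrow> 'a set \<Rightarrow> 'a ugraph" where
  "biclique L R = (L \<union> R, {{u, v} | u v. u \<in> L \<and> v \<in> R})"

definition is_biclique :: "'a ugraph \<Rightarrow> bool" where
  "is_biclique H \<longleftrightarrow> (\<exists>L R. L \<inter> R = {} \<and> H = biclique L R)"

text \<open>
  A biclique with an empty side has no edges, so allowing such bicliques, as here, does not
  affect the minimum size of a partition.
\<close>

definition biclique_partition :: "'a ugraph \<Rightarrow> 'a ugraph set \<Rightarrow> bool" where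
  "biclique_partition G P \<longleftrightarrow>
     (\<forall>B\<in>P. is_biclique B \<and> subgraph_of B G) \<and> (\<forall>e\<in>snd G. \<exists>!B. B \<in> P \<and> e \<in> snd B)"

definition bp :: "'a ugraph \<Rightarrow> nat" where
  "bp G = (LEAST k. \<exists>P. biclique_partition G P \<and> finite P \<and> card P = k)"

end

theory Submission
  imports Defs Complex_Main
begin

text \<open>
  Let \<open>V1\<close> be the clique and \<open>V2\<close> the independent set of a split partition. A maximal clique of
  the complement contains at most one vertex of \<open>V1\<close>; if it contains \<open>v \<in> V1\<close> it consists of \<open>v\<close>
  and its non-neighbours in \<open>V2\<close>, and otherwise it is \<open>V2\<close>. So the complement has at most
  \<open>card V1 + 1\<close> maximal cliques. A biclique partition restricts to one of the complete graph on
  \<open>V1\<close>, hence has at least \<open>card V1 - 1\<close> members by the Graham-Pollak theorem.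
\<close>

text \<open>Gaussian elimination by induction on the equations: one equation is solved for an
  unknown with nonzero coefficient, which leaves one equation and one unknown fewer.\<close>

lemma homogeneous_system_nontrivial_solution:
  fixes a :: "'i \<Rightarrow> 'k \<Rightarrow> 'f::field"
  assumes "finite I" "finite K" "card I < card K"
  shows "\<exists>x. (\<exists>k\<in>K. x k \<noteq> 0) \<and> (\<forall>i\<in>I. (\<Sum>k\<in>K. a i k * x k) = 0)"
  using assms
proof (induction I arbitrary: a K rule: finite_induct)
  case empty
  then obtain k where "k \<in> K" by fastforce
  then show ?case by (intro exI[of _ "\<lambda>_. 1"]) auto
next
  case (insert i I)
  show ?case
  proof (cases "\<forall>k\<in>K. a i k = 0")
    case True
    moreover obtain x where "\<exists>k\<in>K. x k \<noteq> 0" "\<forall>j\<in>I. (\<Sum>k\<in>K. a j k * x k) = 0"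
      using insert.IH[of K a] insert.prems insert.hyps by auto
    ultimately show ?thesis by (intro exI[of _ x]) auto
  next
    case False
    then obtain p where p: "p \<in> K" "a i p \<noteq> 0" by blast
    let ?K = "K - {p}"
    \<comment> \<open>Row \<open>j\<close> minus the multiple of row \<open>i\<close> that cancels
      the coefficient of \<open>p\<close>.\<close>
    define a' where "a' j k = a j k - a j p * a i k / a i p" for j k
    have "card I < card ?K"
      using insert.prems insert.hyps p by simp
    then obtain x where x: "\<exists>k\<in>?K. x k \<noteq> 0" "\<forall>j\<in>I. (\<Sum>k\<in>?K. a' j k * x k) = 0"
      using insert.IH[of ?K a'] insert.prems by auto
    define s where "s = (\<Sum>k\<in>?K. a i k * x k)"
    \<comment> \<open>The value at \<open>p\<close> is the one that equation \<open>i\<close>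
      forces.\<close>
    define y where "y = x(p := - s / a i p)"
    have sum_y: "(\<Sum>k\<in>K. a j k * y k) = (\<Sum>k\<in>?K. a j k * x k) - a j p * s / a i p" for j
    proof -
      have "(\<Sum>k\<in>K. a j k * y k) = a j p * y p + (\<Sum>k\<in>?K. a j k * y k)"
        using p insert.prems by (simp add: sum.remove)
      also have "(\<Sum>k\<in>?K. a j k * y k) = (\<Sum>k\<in>?K. a j k * x k)"
        by (intro sum.cong) (auto simp: y_def)
      finally show ?thesis by (simp add: y_def)
    qed
    have "(\<Sum>k\<in>K. a j k * y k) = 0" if "j \<in> I" for j
    proof -
      have "(\<Sum>k\<in>?K. a' j k * x k) = (\<Sum>k\<in>?K. a j k * x k - a j p / a i p * (a i k * x k))"
        by (intro sum.cong) (auto simp: a'_def algebra_simps)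
      also have "\<dots> = (\<Sum>k\<in>K. a j k * y k)"
        by (simp add: sum_y s_def sum_subtractf sum_distrib_left sum_divide_distrib)
      finally show ?thesis using x(2) that by simp
    qed
    moreover have "(\<Sum>k\<in>K. a i k * y k) = 0"
      using p by (simp add: sum_y s_def)
    moreover have "\<exists>k\<in>K. y k \<noteq> 0"
      using x(1) by (auto simp: y_def)
    ultimately show ?thesis by (intro exI[of _ y]) auto
  qed
qed

lemma doubleton_in_biclique_iff:
  "{u, v} \<in> snd (biclique L R) \<longleftrightarrow> u \<in> L \<and> v \<in> R \<or> u \<in> R \<and> v \<in> L"
  by (auto simp: biclique_def doubleton_eq_iff)

text \<open>Since \<open>L\<close> and \<open>R\<close> are disjoint, at most one orientation of a
  pair fits, so the edge indicator is a sum of two products; by symmetry both contribute equally.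
  The form thus vanishes as soon as its left factor does.\<close>

lemma biclique_quadratic_form:
  fixes x :: "'a \<Rightarrow> 'f::field"
  assumes "L \<inter> R = {}"
  shows "(\<Sum>u\<in>K. \<Sum>v\<in>K. if {u, v} \<in> snd (biclique L R) then x u * x v else 0)
    = 2 * (\<Sum>u\<in>K. of_bool (u \<in> L) * x u) * (\<Sum>v\<in>K. of_bool (v \<in> R) * x v)"
proof -
  let ?l = "\<lambda>u. of_bool (u \<in> L) * x u" and ?r = "\<lambda>u. of_bool (u \<in> R) * x u"
  have "(if {u, v} \<in> snd (biclique L R) then x u * x v else 0) = ?l u * ?r v + ?r u * ?l v" for u v
    using assms by (auto simp: doubleton_in_biclique_iff)
  then have "(\<Sum>u\<in>K. \<Sum>v\<in>K. if {u, v} \<in> snd (biclique L R) then x u * x v else 0)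
    = sum ?l K * sum ?r K + sum ?r K * sum ?l K"
    by (simp only: sum.distrib sum_product)
  then show ?thesis by simp
qed

text \<open>\<open>P\<close> partitions all of \<open>G\<close>; letting the sums run over
  \<open>K\<close> only restricts each biclique to \<open>K\<close> without constructing a new
  partition.\<close>

theorem Graham_Pollak:
  assumes G: "fin_simple_graph G" and K: "K \<subseteq> fst G" "clique K (snd G)"
    and P: "biclique_partition G P" "finite P"
  shows "card K \<le> card P + 1"
proof (rule ccontr)
  assume less: "\<not> card K \<le> card P + 1"
  have finK: "finite K"
    using G K finite_subset by (auto simp: fin_simple_graph_def)
  have "\<forall>B\<in>P. \<exists>L R. L \<inter> R = {} \<and> B = biclique L R"
    using P by (auto simp: biclique_partition_def is_biclique_def)
  then obtain L R where LR: "\<And>B. B \<in> P \<Longrightarrow> L B \<inter> R B = {}" "\<And>B. B \<in> P \<Longrightarrow> B = biclique (L B) (R B)"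
    by metis
  \<comment> \<open>If \<open>x\<close> sums to zero over \<open>K\<close> and over every \<open>L B\<close>, then splitting the off-diagonal part of
    the square of \<open>sum x K\<close> along the bicliques leaves only the sum of the squares of \<open>x\<close>.\<close>
  define a :: "'a ugraph option \<Rightarrow> 'a \<Rightarrow> real" where
    "a i k = (case i of None \<Rightarrow> 1 | Some B \<Rightarrow> of_bool (k \<in> L B))" for i k
  \<comment> \<open>\<open>None\<close> is the equation for the total sum, which accounts for the 1
    in the bound.\<close>
  have "card (insert None (Some ` P)) < card K"
    using less P(2) by (subst card_insert_disjoint) (auto simp: card_image)
  then obtain x where x: "\<exists>k\<in>K. x k \<noteq> 0"
      "\<forall>i\<in>insert None (Some ` P). (\<Sum>k\<in>K. a i k * x k) = 0"
    using homogeneous_system_nontrivial_solution[of "insert None (Some ` P)" K a] finK P(2) by auto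
  have total: "sum x K = 0" and left: "\<And>B. B \<in> P \<Longrightarrow> (\<Sum>k\<in>K. of_bool (k \<in> L B) * x k) = 0"
    using x(2) by (simp_all add: a_def)
  \<comment> \<open>An off-diagonal pair is an edge of the clique and lies in exactly one biclique;
    a diagonal pair lies in none, as the sides are disjoint.\<close>
  have edge: "(\<Sum>B\<in>P. if {u, v} \<in> snd B then x u * x v else 0) = (if u = v then 0 else x u * x v)"
    if "u \<in> K" "v \<in> K" for u v
  proof (cases "u = v")
    case True
    have "{u, u} \<notin> snd B" if "B \<in> P" for B
      using LR that by (metis disjoint_iff doubleton_in_biclique_iff)
    then show ?thesis using True by simp
  next
    case False
    then have "{u, v} \<in> snd G" using K that by (auto simp: clique_def)
    then obtain B where B: "B \<in> P" "{u, v} \<in> snd B" "\<And>B'. B' \<in> P \<Longrightarrow> {u, v} \<in> snd B' \<Longrightarrow> B' = B"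
      using P(1) unfolding biclique_partition_def by metis
    have "{u, v} \<in> snd B' \<longleftrightarrow> B' = B" if "B' \<in> P" for B'
      using B that by blast
    then have "(\<Sum>B'\<in>P. if {u, v} \<in> snd B' then x u * x v else 0)
      = (\<Sum>B'\<in>P. if B' = B then x u * x v else 0)"
      by simp
    then show ?thesis using B(1) P(2) False by simp
  qed
  have "0 = (\<Sum>B\<in>P. \<Sum>u\<in>K. \<Sum>v\<in>K. if {u, v} \<in> snd B then x u * x v else 0)"
  proof (intro sum.neutral[symmetric] ballI)
    fix B assume "B \<in> P"
    then show "(\<Sum>u\<in>K. \<Sum>v\<in>K. if {u, v} \<in> snd B then x u * x v else 0) = 0"
      using biclique_quadratic_form[OF LR(1), of B x K] LR(2)[of B, symmetric] left[of B] by simp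
  qed
  also have "\<dots> = (\<Sum>u\<in>K. \<Sum>B\<in>P. \<Sum>v\<in>K. if {u, v} \<in> snd B then x u * x v else 0)"
    by (rule sum.swap)
  also have "\<dots> = (\<Sum>u\<in>K. \<Sum>v\<in>K. \<Sum>B\<in>P. if {u, v} \<in> snd B then x u * x v else 0)"
    by (intro sum.cong refl sum.swap)
  also have "\<dots> = (\<Sum>u\<in>K. \<Sum>v\<in>K. x u * x v - (if v = u then x u * x u else 0))"
    by (intro sum.cong refl) (auto simp: edge)
  also have "\<dots> = sum x K * sum x K - (\<Sum>u\<in>K. x u * x u)"
    using finK by (simp add: sum_subtractf sum_product)
  finally have "(\<Sum>u\<in>K. x u * x u) = 0" using total by simp
  \<comment> \<open>Here it matters that \<open>x\<close> is real: squares are nonnegative.\<close>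
  then have "\<forall>u\<in>K. x u = 0" using finK by (simp add: sum_nonneg_eq_0_iff)
  with x(1) show False by blast
qed

text \<open>\<open>LEAST\<close> is attained once some finite partition exists; taking every edge as
  its own biclique gives one.\<close>

lemma bp_attained:
  assumes "fin_simple_graph G"
  obtains P where "biclique_partition G P" "finite P" "card P = bp G"
proof -
  let ?P = "(\<lambda>e. (e, {e})) ` snd G"
  have E: "finite (fst G)" "snd G \<subseteq> [fst G]\<^bsup>2\<^esup>"
    using assms by (auto simp: fin_simple_graph_def)
  have "is_biclique (e, {e}) \<and> subgraph_of (e, {e}) G" if edge: "e \<in> snd G" for e
  proof -
    obtain u v where e: "e = {u, v}" "u \<in> fst G" "v \<in> fst G" "u \<noteq> v"
      using nsets2_E[OF subsetD[OF E(2) edge]] by metis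
    have "is_biclique (e, {e})"
      unfolding is_biclique_def
      using e(1,4) by (intro exI[of _ "{u}"] exI[of _ "{v}"]) (auto simp: biclique_def)
    moreover have "subgraph_of (e, {e}) G"
      using e edge by (simp add: subgraph_of_def)
    ultimately show ?thesis ..
  qed
  then have "biclique_partition G ?P"
    by (auto simp: biclique_partition_def)
  moreover have "finite ?P"
    using E finite_imp_finite_nsets finite_subset by blast
  ultimately have "\<exists>k P. biclique_partition G P \<and> finite P \<and> card P = k"
    by blast
  then show thesis
    using that LeastI_ex[of "\<lambda>k. \<exists>P. biclique_partition G P \<and> finite P \<and> card P = k"]
    unfolding bp_def by blast
qed

lemma mc_compl_split_le:
  assumes "finite V1" "V1 \<union> V2 = fst G" "V1 \<inter> V2 = {}" "clique V1 (snd G)" "indep V2 (snd G)"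
  shows "mc (compl_graph G) \<le> card V1 + 1"
proof -
  define N where "N v = insert v {w \<in> V2. {v, w} \<notin> snd G}" for v
  have V: "V1 \<subseteq> fst G" "V2 \<subseteq> fst G" using assms by auto
  have "M \<in> insert V2 (N ` V1)" if M: "maximal_clique (compl_graph G) M" for M
  proof -
    have sub: "M \<subseteq> fst G"
      and nonadj: "\<And>u v. u \<in> M \<Longrightarrow> v \<in> M \<Longrightarrow> u \<noteq> v \<Longrightarrow> {u, v} \<notin> snd G"
      using M by (auto simp: maximal_clique_def compl_graph_def clique_def)
    \<comment> \<open>Maximality restated through non-adjacency in \<open>G\<close>, to be applied
      to the candidates \<open>V2\<close> and \<open>N v\<close>.\<close>
    have maximal: "K = M" if "M \<subseteq> K" "K \<subseteq> fst G"
        "\<And>u v. u \<in> K \<Longrightarrow> v \<in> K \<Longrightarrow> u \<noteq> v \<Longrightarrow> {u, v} \<notin> snd G" for K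
    proof -
      have "clique K (snd (compl_graph G))"
        using that(2,3) by (auto simp: compl_graph_def clique_def)
      then show ?thesis
        using M that(1,2) by (auto simp: maximal_clique_def compl_graph_def)
    qed
    show ?thesis
    proof (cases "M \<inter> V1 = {}")
      case True
      then have "V2 = M"
        using sub assms V by (intro maximal) (auto simp: indep_def)
      then show ?thesis by simp
    next
      case False
      then obtain v where v: "v \<in> M" "v \<in> V1" by blast
      have "N v = M"
      proof (rule maximal)
        show "M \<subseteq> N v"
        proof
          fix w assume "w \<in> M"
          moreover from this have "w \<in> V1 \<or> w \<in> V2"
            using sub assms(2) by blast
          ultimately show "w \<in> N v"
            using nonadj[of v w] v assms(4) by (auto simp: N_def clique_def)
        qed
        show "N v \<subseteq> fst G" using v V by (auto simp: N_def)
        show "{u, w} \<notin> snd G" if "u \<in> N v" "w \<in> N v" "u \<noteq> w" for u w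
          using that assms(5) by (auto simp: N_def indep_def insert_commute)
      qed
      then show ?thesis using v by blast
    qed
  qed
  \<comment> \<open>Only an upper bound: \<open>V2\<close> is not maximal when some vertex of
    \<open>V1\<close> has no neighbour in \<open>V2\<close>.\<close>
  then have "mc (compl_graph G) \<le> card (insert V2 (N ` V1))"
    unfolding mc_def using assms(1) by (intro card_mono) auto
  also have "\<dots> \<le> card (N ` V1) + 1"
    using assms(1) by (simp add: card_insert_if)
  also have "\<dots> \<le> card V1 + 1"
    using assms(1) by (simp add: card_image_le)
  finally show ?thesis .
qed

theorem theorem7:
  fixes G :: "'a ugraph"
  assumes "split_graph G"
  shows "int (bp G) \<ge> int (mc (compl_graph G)) - 2"
proof -
  obtain V1 V2 where G: "fin_simple_graph G"
    and V: "V1 \<union> V2 = fst G" "V1 \<inter> V2 = {}" "clique V1 (snd G)" "indep V2 (snd G)"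
    using assms by (auto simp: split_graph_def)
  have "finite V1"
    using G V(1) by (metis fin_simple_graph_def finite_Un)
  then have "mc (compl_graph G) \<le> card V1 + 1"
    using V by (rule mc_compl_split_le)
  moreover obtain P where "biclique_partition G P" "finite P" "card P = bp G"
    using bp_attained[OF G] .
  then have "card V1 \<le> bp G + 1"
    using Graham_Pollak[OF G _ V(3)] V(1) by fastforce
  \<comment> \<open>The 2 is made up of the extra candidate \<open>V2\<close> and the 1 in
    \<open>Graham_Pollak\<close>.\<close>
  ultimately show ?thesis by linarith
qed

end
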